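(* Let $n$ be a positive integer and let $r(x)$ be a proper rational function (with complex coefficients) all of whose poles are primitive $n$-th roots of unity. Then $r$ is the generating function of a quasi-polynomial, i.e. $$r(x) = \sum_{k\ge 0}\left(c_d(k)\,k^d + c_{d-1}(k)\,k^{d-1} + \dots + c_0(k)\right)x^k$$ for some $d\ge 0$ and periodic functions $c_0,\dots,c_d$ on $\mathbb{Z}$, where each $c_j$ is either identically zero or has minimum period $n$.
   Context: A quasi-polynomial is a function on $\mathbb{Z}$ of the form $q(k) = c_d(k)k^d + \dots + c_0(k)$ where $c_0,\dots,c_d$ are periodic (complex-valued) functions of $k\in\mathbb{Z}$, called the coefficient functions of $q$; they are uniquely determined by the values $q(k)$, $k\ge 0$. The minimum period of a periodic function $c$ on $\mathbb{Z}$ is the smallest positive integer $p$ with $c(k+p)=c(k)$ for all $k\in\mathbb{Z}$. A rational function is proper if the degree of its numerator is less than the degree of its denominator. The displayed equality is that of $r$ with its power series expansion at $x=0$. *)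

theory Defs
  imports Complex_Main "HOL-Computational_Algebra.Computational_Algebra"
    "HOL-Computational_Algebra.Field_as_Ring"
begin

text \<open>
  Rational functions over the complex numbers are elements of the fraction field
  \<^typ>\<open>complex poly fract\<close>; \<^const>\<open>quot_of_fract\<close> yields the numerator and denominator in
  lowest terms, with monic denominator.
\<close>

definition rat_num :: "complex poly fract \<Rightarrow> complex poly" where
  "rat_num r = fst (quot_of_fract r)"

definition rat_denom :: "complex poly fract \<Rightarrow> complex poly" where
  "rat_denom r = snd (quot_of_fract r)"

text \<open>
  The zero polynomial has degree \<open>-\<infinity>\<close> here, so that the zero function is proper; since
  \<^const>\<open>degree\<close> maps \<open>0\<close> to \<open>0\<close>, this case is listed separately.
\<close>

definition proper_rat :: "complex poly fract \<Rightarrow> bool" where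
  "proper_rat r \<longleftrightarrow> rat_num r = 0 \<or> degree (rat_num r) < degree (rat_denom r)"

definition rat_poles :: "complex poly fract \<Rightarrow> complex set" where
  "rat_poles r = {z. poly (rat_denom r) z = 0}"

text \<open>
  The power series expansion at \<open>0\<close>. It is meaningful only if \<open>0\<close> is not a pole of \<open>r\<close>: the
  denominator is then a unit in the ring of formal power series.
\<close>

definition rat_expansion :: "complex poly fract \<Rightarrow> complex fps" where
  "rat_expansion r = fps_of_poly (rat_num r) / fps_of_poly (rat_denom r)"

definition primitive_root_of_unity :: "nat \<Rightarrow> complex \<Rightarrow> bool" where
  "primitive_root_of_unity n z \<longleftrightarrow> 0 < n \<and> z ^ n = 1 \<and> (\<forall>m. 0 < m \<and> m < n \<longrightarrow> z ^ m \<noteq> 1)"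

definition has_period :: "(int \<Rightarrow> complex) \<Rightarrow> nat \<Rightarrow> bool" where
  "has_period c p \<longleftrightarrow> 0 < p \<and> (\<forall>k. c (k + int p) = c k)"

definition periodic :: "(int \<Rightarrow> complex) \<Rightarrow> bool" where
  "periodic c \<longleftrightarrow> (\<exists>p. has_period c p)"

text \<open>Unspecified for functions that are not periodic.\<close>

definition min_period :: "(int \<Rightarrow> complex) \<Rightarrow> nat" where
  "min_period c = (LEAST p. has_period c p)"

text \<open>
  The function \<open>c\<^sub>d(k) k^d + \<dots> + c\<^sub>0(k)\<close>. It is a quasi-polynomial if \<open>c\<^sub>0, \<dots>, c\<^sub>d\<close> are periodic.
\<close>

definition quasi_poly :: "nat \<Rightarrow> (nat \<Rightarrow> int \<Rightarrow> complex) \<Rightarrow> int \<Rightarrow> complex" where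
  "quasi_poly d c k = (\<Sum>j\<le>d. c j k * of_int k ^ j)"

end

theory Submission
  imports Defs
begin

text \<open>
  By partial fractions, the coefficients of the expansion of \<open>r\<close> have the form
  \<open>\<Sum>w\<in>W. P\<^sub>w(k) w\<^sup>k\<close> with polynomials \<open>P\<^sub>w\<close>, where \<open>W\<close> is the set of primitive \<open>n\<close>-th roots of
  unity (which is closed under inverses). Hence the coefficient function \<open>c\<^sub>j\<close> can be taken to be a
  linear combination of the functions \<open>w\<^sup>k\<close> with \<open>w \<in> W\<close>. These are linearly independent, so if
  \<open>p\<close> is a period of \<open>c\<^sub>j \<noteq> 0\<close>, then \<open>w\<^sup>p = 1\<close> for some \<open>w \<in> W\<close>, which forces \<open>p \<ge> n\<close>.
\<close>

text \<open>The set of bases is fixed in advance and one polynomial is attached to each base,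
  possibly 0. Sums of such series are then handled by adding polynomials base by base.\<close>

definition exp_poly_fps :: "'a::field_char_0 set \<Rightarrow> 'a fps \<Rightarrow> bool" where
  "exp_poly_fps W f \<longleftrightarrow> (\<exists>P. \<forall>k. fps_nth f k = (\<Sum>w\<in>W. poly (P w) (of_nat k) * w ^ k))"

lemma exp_poly_fps_0: "exp_poly_fps W 0"
  unfolding exp_poly_fps_def by (rule exI[of _ "\<lambda>_. 0"]) simp

lemma exp_poly_fps_add:
  assumes "exp_poly_fps W f" "exp_poly_fps W g"
  shows "exp_poly_fps W (f + g)"
proof -
  obtain P Q where "\<And>k. fps_nth f k = (\<Sum>w\<in>W. poly (P w) (of_nat k) * w ^ k)"
    "\<And>k. fps_nth g k = (\<Sum>w\<in>W. poly (Q w) (of_nat k) * w ^ k)"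
    using assms unfolding exp_poly_fps_def by blast
  then show ?thesis
    unfolding exp_poly_fps_def
    by (intro exI[of _ "\<lambda>w. P w + Q w"]) (simp add: sum.distrib algebra_simps)
qed

lemma exp_poly_fps_single:
  assumes "finite W" "w \<in> W" "\<And>k. fps_nth f k = poly p (of_nat k) * w ^ k"
  shows "exp_poly_fps W f"
proof -
  have "fps_nth f k = (\<Sum>v\<in>W. poly (if v = w then p else 0) (of_nat k) * v ^ k)" for k
  proof -
    have "(\<Sum>v\<in>W. poly (if v = w then p else 0) (of_nat k) * v ^ k) =
        (\<Sum>v\<in>W. if v = w then poly p (of_nat k) * w ^ k else 0)"
      by (rule sum.cong) auto
    then show ?thesis
      using assms by simp
  qed
  then show ?thesis
    unfolding exp_poly_fps_def by (intro exI[of _ "\<lambda>v. if v = w then p else 0"]) blast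
qed

text \<open>This is the negative binomial series, stated as a product so that the induction needs no
  inverses: multiplying by one factor \<open>1 - w x\<close> lowers \<open>m\<close> by one, by
  Pascal's rule.\<close>

lemma binomial_fps_mult_one_minus_power:
  fixes w :: "'a::field_char_0"
  shows "Abs_fps (\<lambda>k. of_nat ((k + m) choose m) * w ^ k) * (1 - fps_const w * fps_X) ^ Suc m = 1"
proof (induction m)
  case 0
  show ?case
  proof (rule fps_ext)
    fix k
    show "fps_nth (Abs_fps (\<lambda>k. of_nat ((k + 0) choose 0) * w ^ k) *
        (1 - fps_const w * fps_X) ^ Suc 0) k = fps_nth 1 k"
      by (cases k) (simp_all add: right_diff_distrib mult.left_commute[of _ "fps_const w"])
  qed
next
  case (Suc m)
  have "Abs_fps (\<lambda>k. of_nat ((k + Suc m) choose Suc m) * w ^ k) * (1 - fps_const w * fps_X) =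
      Abs_fps (\<lambda>k. of_nat ((k + m) choose m) * w ^ k)"
  proof (rule fps_ext)
    fix k
    show "fps_nth (Abs_fps (\<lambda>k. of_nat ((k + Suc m) choose Suc m) * w ^ k) *
        (1 - fps_const w * fps_X)) k =
      fps_nth (Abs_fps (\<lambda>k. of_nat ((k + m) choose m) * w ^ k)) k"
      by (cases k)
        (simp_all add: ring_distribs mult.left_commute[of _ "fps_const w"])
  qed
  then show ?case
    using Suc.IH by (simp add: mult.assoc[symmetric])
qed

text \<open>Writing \<open>x - z = -z (1 - x/z)\<close> reduces this to the negative binomial
  series, so a pole at \<open>z\<close> contributes powers of \<open>inverse z\<close>.\<close>

lemma exp_poly_fps_inverse_linear_power:
  fixes z :: "'a::field_char_0"
  assumes "finite W" "inverse z \<in> W" "z \<noteq> 0"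
  shows "exp_poly_fps W (fps_const c * inverse (fps_of_poly ([:- z, 1:] ^ Suc m)))"
proof -
  define w where "w = inverse z"
  define F where "F = Abs_fps (\<lambda>k. of_nat ((k + m) choose m) * w ^ k)"
  define b where "b = (- z) ^ Suc m"
  have b: "b \<noteq> 0"
    using assms by (simp add: b_def)
  have "fps_of_poly [:- z, 1:] = fps_const (- z) * (1 - fps_const w * fps_X)"
    using assms by (simp add: fps_of_poly_linear w_def algebra_simps flip: mult.assoc)
  then have "fps_of_poly ([:- z, 1:] ^ Suc m) =
      fps_const b * (1 - fps_const w * fps_X) ^ Suc m"
    by (simp only: fps_of_poly_power power_mult_distrib fps_const_power b_def)
  moreover have "F * (1 - fps_const w * fps_X) ^ Suc m = 1"
    unfolding F_def by (rule binomial_fps_mult_one_minus_power)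
  then have "inverse ((1 - fps_const w * fps_X) ^ Suc m) = F"
    by (metis fps_inverse_unique mult.commute)
  ultimately have "fps_const c * inverse (fps_of_poly ([:- z, 1:] ^ Suc m)) =
      fps_const (c / b) * F"
    using b by (simp only: fps_inverse_mult fps_const_inverse)
      (simp add: field_simps flip: mult.assoc)
  moreover
  \<comment> \<open>As a function of \<open>k\<close>, the binomial coefficient is the polynomial
    \<open>(k+1)...(k+m) / m!\<close>, obtained as a Pochhammer product starting at
    \<open>x + 1\<close> in the polynomial ring.\<close>
  define p where "p = smult (c / b / fact m) (pochhammer [:1, 1:] m)"
  have "fps_nth (fps_const (c / b) * F) k = poly p (of_nat k) * w ^ k" for k
  proof -
    have 1: "(of_nat ((k + m) choose m) :: 'a) = pochhammer (of_nat k + 1) m / fact m"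
      by (simp add: binomial_gbinomial gbinomial_pochhammer')
    have 2: "poly (pochhammer [:1, 1:] m) x = pochhammer (x + 1) m" for x :: 'a
      by (induction m) (simp_all add: pochhammer_rec' add_ac flip: of_nat_poly)
    show ?thesis
      unfolding F_def p_def fps_mult_left_const_nth fps_nth_Abs_fps poly_smult 1 2
      by simp
  qed
  ultimately show ?thesis
    using assms by (intro exp_poly_fps_single[of W w _ p]) (simp_all add: w_def)
qed

text \<open>Partial fractions, lowering the order of one pole by one in each step: with
  \<open>q = L^(m+1) q'\<close> for a linear factor \<open>L\<close>, one has
  \<open>p/q = s/(L^m q') + c/L^(m+1)\<close>. The new fraction may fail to be in lowest terms, so
  coprimality is not part of the induction.\<close>

lemma exp_poly_fps_divide:
  fixes p q :: "complex poly"
  assumes "finite W" "0 \<notin> W" "q \<noteq> 0" "p = 0 \<or> degree p < degree q"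
    and "\<And>z. poly q z = 0 \<Longrightarrow> inverse z \<in> W"
  shows "exp_poly_fps W (fps_of_poly p / fps_of_poly q)"
  using assms(3-)
proof (induction "degree q" arbitrary: p q rule: less_induct)
  case less
  show ?case
  proof (cases "p = 0")
    case True
    then show ?thesis
      by (simp add: exp_poly_fps_0)
  next
    case False
    then have deg: "degree p < degree q"
      using less.prems by simp
    then obtain z where z: "poly q z = 0"
      using fundamental_theorem_of_algebra[of q] constant_degree[of q] by auto
    \<comment> \<open>Since \<open>inverse 0 = 0\<close>, a root of \<open>q\<close> at 0 would put
      0 into \<open>W\<close>.\<close>
    have z0: "z \<noteq> 0"
      using less.prems(3)[OF z] assms(2) by auto
    obtain q' where q: "q = [:- z, 1:] ^ order z q * q'" and ndvd: "\<not> [:- z, 1:] dvd q'"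
      using order_decomp[OF less.prems(1)] by blast
    obtain m where m: "order z q = Suc m"
      using z less.prems(1) by (metis order_root not0_implies_Suc)
    define L where "L = [:- z, 1:]"
    have q: "q = L ^ Suc m * q'"
      using q m by (simp add: L_def)
    \<comment> \<open>This value makes \<open>p - c q'\<close> vanish at \<open>z\<close>, so that
      one factor \<open>L\<close> cancels.\<close>
    define c where "c = poly p z / poly q' z"
    have q'z: "poly q' z \<noteq> 0"
      using ndvd by (simp add: poly_eq_0_iff_dvd)
    then have "poly (p - smult c q') z = 0"
      by (simp add: c_def)
    then obtain s where s: "p - smult c q' = L * s"
      unfolding poly_eq_0_iff_dvd L_def by (elim dvdE)
    define q1 where "q1 = L ^ m * q'"
    have L: "L \<noteq> 0" "degree L = 1"
      by (simp_all add: L_def)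
    have q': "q' \<noteq> 0"
      using q'z by auto
    have dq: "degree q = Suc (degree q1)" "degree q' \<le> degree q1"
      using L q' by (simp_all add: q q1_def degree_mult_eq degree_power_eq)
    have "s = 0 \<or> degree s < degree q1"
    proof (cases "s = 0")
      case False
      then have "Suc (degree s) = degree (p - smult c q')"
        using L by (simp add: s degree_mult_eq)
      also have "\<dots> \<le> degree q1"
        using deg dq by (intro degree_diff_le) (auto intro: order.trans[OF degree_smult_le])
      finally show ?thesis by simp
    qed simp
    then have IH: "exp_poly_fps W (fps_of_poly s / fps_of_poly q1)"
      using L q' less.prems(3) dq by (intro less.hyps) (auto simp: q1_def q)
    \<comment> \<open>All divisors of \<open>q\<close> have nonzero constant term and hence are
      units among power series, which allows the quotient to be split.\<close>
    have nz: "fps_nth (fps_of_poly f) 0 \<noteq> 0" if "f dvd q" for f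
    proof
      assume "fps_nth (fps_of_poly f) 0 = 0"
      then have "poly q 0 = 0"
        using that by (auto simp: poly_0_coeff_0 coeff_mult_0)
      then show False
        using less.prems(3)[of 0] assms(2) by simp
    qed
    have nzs: "fps_nth (fps_of_poly q) 0 \<noteq> 0" "fps_nth (fps_of_poly q1) 0 \<noteq> 0"
      "fps_nth (fps_of_poly L) 0 \<noteq> 0" "fps_nth (fps_of_poly q') 0 \<noteq> 0"
      by (intro nz; simp add: q q1_def)+
    have p: "p = L * s + smult c q'"
      using s by (simp add: algebra_simps)
    have "fps_of_poly p / fps_of_poly q = fps_of_poly s / fps_of_poly q1 +
        fps_const c * inverse (fps_of_poly (L ^ Suc m))"
    proof -
      have 1: "fps_of_poly L * inverse (fps_of_poly L) = 1"
        "fps_of_poly q' * inverse (fps_of_poly q') = 1"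
        using nzs by (simp_all add: inverse_mult_eq_1')
      have q_eq: "fps_of_poly q = fps_of_poly L * fps_of_poly q1"
        "fps_of_poly q = fps_of_poly q' * fps_of_poly (L ^ Suc m)"
        by (simp_all add: q q1_def mult_ac flip: fps_of_poly_mult)
      have 2: "inverse (fps_of_poly q) = inverse (fps_of_poly L) * inverse (fps_of_poly q1)"
        "inverse (fps_of_poly q) = inverse (fps_of_poly q') * inverse (fps_of_poly (L ^ Suc m))"
        by (simp_all only: fps_inverse_mult[symmetric] q_eq[symmetric])
      have "fps_of_poly L * inverse (fps_of_poly q) = inverse (fps_of_poly q1)"
        by (simp only: 2(1) mult.assoc[symmetric] 1 mult_1_left)
      moreover have "fps_of_poly q' * inverse (fps_of_poly q) = inverse (fps_of_poly (L ^ Suc m))"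
        by (simp only: 2(2) mult.assoc[symmetric] 1 mult_1_left)
      moreover have "fps_of_poly p / fps_of_poly q =
          fps_of_poly s * (fps_of_poly L * inverse (fps_of_poly q)) +
          fps_const c * (fps_of_poly q' * inverse (fps_of_poly q))"
        unfolding fps_divide_unit[OF nzs(1)] p fps_of_poly_add fps_of_poly_mult fps_of_poly_smult
        by (simp add: algebra_simps)
      ultimately show ?thesis
        by (simp only: fps_divide_unit[OF nzs(2)])
    qed
    moreover have "exp_poly_fps W (fps_const c * inverse (fps_of_poly (L ^ Suc m)))"
      unfolding L_def using assms(1) less.prems(3)[OF z] z0
      by (rule exp_poly_fps_inverse_linear_power)
    ultimately show ?thesis
      using exp_poly_fps_add[OF IH] by simp
  qed
qed

text \<open>Combining the relations with the coefficients of a polynomial \<open>f\<close> that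
  vanishes on \<open>W\<close> except at \<open>v\<close> leaves only
  \<open>b v * poly f v = 0\<close>.\<close>

lemma linear_independent_powers:
  fixes b :: "'a::field \<Rightarrow> 'a"
  assumes "finite W" "\<And>k. (\<Sum>w\<in>W. b w * w ^ k) = 0" "v \<in> W"
  shows "b v = 0"
proof -
  define f where "f = (\<Prod>w\<in>W - {v}. [:- w, 1:])"
  have f: "poly f w = 0" if "w \<in> W - {v}" for w
    using that assms(1) by (auto simp: f_def poly_prod)
  have fv: "poly f v \<noteq> 0"
    using assms(1) by (auto simp: f_def poly_prod)
  have "(\<Sum>w\<in>W. b w * poly f w) = (\<Sum>w\<in>W. \<Sum>i\<le>degree f. coeff f i * (b w * w ^ i))"
    by (simp add: poly_altdef sum_distrib_left mult_ac)
  also have "\<dots> = (\<Sum>i\<le>degree f. coeff f i * (\<Sum>w\<in>W. b w * w ^ i))"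
    by (subst sum.swap) (simp add: sum_distrib_left)
  also have "\<dots> = 0"
    by (simp add: assms(2))
  finally have "(\<Sum>w\<in>W. b w * poly f w) = 0" .
  moreover have "(\<Sum>w\<in>W. b w * poly f w) = b v * poly f v"
    using assms f by (simp add: sum.remove[of W v])
  ultimately show ?thesis
    using fv by simp
qed

theorem corollary5:
  fixes n :: nat and r :: "complex poly fract"
  assumes "n > 0"
    and "proper_rat r"
    and "\<forall>z\<in>rat_poles r. primitive_root_of_unity n z"
  shows "\<exists>(d::nat) (c :: nat \<Rightarrow> int \<Rightarrow> complex).
    (\<forall>j\<le>d. periodic (c j)) \<and>
    rat_expansion r = Abs_fps (\<lambda>k. quasi_poly d c (int k)) \<and>
    (\<forall>j\<le>d. c j = (\<lambda>k. 0) \<or> min_period (c j) = n)"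
proof -
  define W where "W = {z. primitive_root_of_unity n z}"
  have "W \<subseteq> {z. z ^ n = 1}"
    by (auto simp: W_def primitive_root_of_unity_def)
  then have fin: "finite W"
    using finite_roots_unity[of n] assms(1) by (auto intro: finite_subset)
  have W0: "0 \<notin> W"
    using assms(1) by (simp add: W_def primitive_root_of_unity_def zero_power)
  have inv: "inverse z \<in> W" if "poly (rat_denom r) z = 0" for z
    using that assms(3)
    by (auto simp: W_def rat_poles_def primitive_root_of_unity_def power_inverse)
  have "exp_poly_fps W (rat_expansion r)"
    unfolding rat_expansion_def using assms(2) inv
    by (intro exp_poly_fps_divide fin W0) (auto simp: proper_rat_def rat_denom_def)
  then obtain P where P: "\<And>k. fps_nth (rat_expansion r) k =
      (\<Sum>w\<in>W. poly (P w) (of_nat k) * w ^ k)"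
    unfolding exp_poly_fps_def by blast
  \<comment> \<open>The sum of the degrees serves as a common bound for all of them.\<close>
  define d where "d = (\<Sum>w\<in>W. degree (P w))"
  \<comment> \<open>Collecting the terms with \<open>k^j\<close> gives \<open>c j\<close>; integer
    powers extend it to negative \<open>k\<close>.\<close>
  define c where "c = (\<lambda>j k. \<Sum>w\<in>W. coeff (P w) j * w powi k)"
  \<comment> \<open>A shift by \<open>p\<close> scales the coefficient of each \<open>w\<close> by
    \<open>w ^ p\<close>. This gives the period \<open>n\<close> and, for an arbitrary period, a
    linear relation between the powers.\<close>
  have shift: "c j (k + int p) = (\<Sum>w\<in>W. coeff (P w) j * w ^ p * w powi k)" for j k p
  proof -
    have "w powi (k + int p) = w ^ p * w powi k" if "w \<in> W" for w
      using that W0 by (subst power_int_add) auto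
    then show ?thesis
      by (simp add: c_def mult.assoc)
  qed
  have per: "has_period (c j) n" for j
    unfolding has_period_def shift using assms(1)
    by (auto simp: c_def W_def primitive_root_of_unity_def intro!: sum.cong)
  have "rat_expansion r = Abs_fps (\<lambda>k. quasi_poly d c (int k))"
  proof (rule fps_ext)
    fix k
    have "poly (P w) (of_nat k) = (\<Sum>j\<le>d. coeff (P w) j * of_nat k ^ j)" if "w \<in> W" for w
    proof -
      have "degree (P w) \<le> d"
        unfolding d_def using that fin by (intro member_le_sum) auto
      then show ?thesis
        unfolding poly_altdef by (intro sum.mono_neutral_left) (auto simp: coeff_eq_0 not_le)
    qed
    then have "fps_nth (rat_expansion r) k =
        (\<Sum>w\<in>W. \<Sum>j\<le>d. coeff (P w) j * w ^ k * of_nat k ^ j)"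
      by (simp add: P sum_distrib_left mult_ac)
    also have "\<dots> = quasi_poly d c (int k)"
      by (subst sum.swap) (simp add: quasi_poly_def c_def sum_distrib_right)
    finally show "fps_nth (rat_expansion r) k =
        fps_nth (Abs_fps (\<lambda>k. quasi_poly d c (int k))) k" by simp
  qed
  moreover have "min_period (c j) = n" if nz: "c j \<noteq> (\<lambda>k. 0)" for j
    unfolding min_period_def
  proof (rule Least_equality)
    fix p
    assume p: "has_period (c j) p"
    have "\<exists>v\<in>W. coeff (P v) j \<noteq> 0"
      using nz by (rule contrapos_np) (auto simp: c_def)
    then obtain v where v: "v \<in> W" "coeff (P v) j \<noteq> 0" by blast
    \<comment> \<open>For a period \<open>p\<close> the right-hand side is 0; its vanishing at
      natural numbers \<open>k\<close> is all that linear independence requires.\<close>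
    have "(\<Sum>w\<in>W. coeff (P w) j * (w ^ p - 1) * w ^ k) = c j (int k + int p) - c j (int k)" for k
      unfolding shift by (simp add: c_def algebra_simps sum_subtractf)
    then have "coeff (P v) j * (v ^ p - 1) = 0"
      using p v by (intro linear_independent_powers[OF fin, of "\<lambda>w. coeff (P w) j * (w ^ p - 1)"])
        (simp_all add: has_period_def)
    then have "v ^ p = 1"
      using v by simp
    moreover have "p > 0"
      using p by (simp add: has_period_def)
    moreover have "\<forall>m. 0 < m \<and> m < n \<longrightarrow> v ^ m \<noteq> 1"
      using v(1) by (simp add: W_def primitive_root_of_unity_def)
    ultimately show "n \<le> p"
      by (meson not_le)
  qed (rule per)
  ultimately show ?thesis
    using per by (intro exI[of _ d] exI[of _ c]) (auto simp: periodic_def)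
qed

end
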